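(* Let $a_1(n),a_2(n),a_3(n),m(n)$ be integer-valued quasi-polynomials with positive leading coefficients. Let $$d_0(n)=\mathrm{ggcd}(a_1(n),a_2(n),a_3(n)),\qquad m'(n)=\frac{m(n)}{d_0(n)},\qquad a_i'(n)=\frac{a_i(n)}{d_0(n)}\ (i=1,2,3),\qquad d(n)=\mathrm{ggcd}(a_1'(n),a_2'(n)),$$ $$x_0=\bigg\{\frac{m'(n)a_3'(n)^{-1}}{d(n)}\bigg\}d(n),\qquad \widetilde{m'(n)}=\frac{m'(n)-a_3'(n)x_0}{d(n)},\qquad \widetilde{a_i'(n)}=\frac{a_i'(n)}{d(n)}\ (i=1,2),$$ where $a_3'(n)^{-1}$ is an inverse of $a_3'(n)$ mod $d(n)$. Let $\chi(m(n),d_0(n))=1$ if $d_0(n)\mid m(n)$ and $0$ otherwise. Write $m,a_1,a_2,a_3$ for $\widetilde{m'(n)},\widetilde{a_1'(n)},\widetilde{a_2'(n)},a_3'(n)$ respectively, let $a_1^{-1}$ be an inverse of $a_1=\widetilde{a_1'(n)}$ mod $a_2=\widetilde{a_2'(n)}$, and let $a_2^{-1}$ be an inverse of $a_2$ mod $a_1$. Then, for all sufficiently large $n\in\mathbb{N}$, $$p_{\{a_1(n),a_2(n),a_3(n)\}}(m(n))=\chi(m(n),d_0(n))\bigg(C-\frac{1}{a_2}S\Big(0,\Big[\frac{m}{a_3}\Big],ma_1^{-1};-a_3a_1^{-1},a_2\Big)-\frac{1}{a_1}S\Big(0,\Big[\frac{m}{a_3}\Big],ma_2^{-1};-a_3a_2^{-1},a_1\Big)\bigg),$$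 where $$C=\sum_{x=0}^{[\frac{m}{a_3}]}\bigg(\frac{m-a_3x}{a_1a_2}+1\bigg).$$ (The right-hand side is read as $0$ when $\chi(m(n),d_0(n))=0$.)
   Context: $\mathbb{N}=\{0,1,2,\dots\}$; for rational $y$, $[y]$ is the floor and $\{y\}=y-[y]$ is the fractional part. For integers $r_1,\dots,r_5$ with $r_5\ne0$, $$S(r_1,r_2,r_3;r_4,r_5)=\sum_{x=r_1}^{r_2}\Big\{\frac{r_3+r_4x}{r_5}\Big\}r_5;$$ in the claim it is evaluated pointwise in $n$. A sum $\sum_{x=0}^{K}$ with $K<0$ is $0$. An integer-valued quasi-polynomial is a function $f:\mathbb{N}\to\mathbb{Z}$ for which there exist positive integers $T,C$ and polynomials $f_i(x)\in\mathbb{Z}[x]$ ($0\le i\le T-1$) such that $f(n)=f_i(m)$ whenever $n>C$, $n=Tm+i$, $m\in\mathbb{N}$. These form a commutative ring $R$ under pointwise operations; identities in $R$ are understood for all sufficiently large $n$. We say $f$ has positive leading coefficients if all $f_i$ are nonzero with positive leading coefficient, and we write $f\succcurlyeq 0$ if each $f_i$ is zero or has positive leading coefficient (equivalently $f(n)\ge0$ for all large $n$). For $f,g\in R$, $g\mid f$ in $R$ means $g(n)\neq0$ and $g(n)$ divides $f(n)$ in $\mathbb{Z}$, for all sufficiently large $n$. For $f_1,\dots,f_s\in R$, $\mathrm{ggcd}(f_1,\dots,f_s)$ is the greatest common divisor $d\in R$ with $d\succcurlyeq0$: $d\mid f_k$ for all $k$, and every $p\in R$ with $p\mid f_k$ for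 all $k$ satisfies $p\mid d$. If $\mathrm{ggcd}(b_1,b_2)=1$, there exist $u_1,u_2\in R$ with $b_1u_1+b_2u_2=1$; for any such pair, $u_1$ is called an inverse of $b_1$ mod $b_2$ (denoted $b_1^{-1}$) and $u_2$ an inverse of $b_2$ mod $b_1$ (denoted $b_2^{-1}$). The condition $d_0(n)\mid m(n)$ in the definition of $\chi$ is ordinary divisibility of integers at the given $n$. For positive integers $b_1,b_2,b_3$ and an integer $t$, $p_{\{b_1,b_2,b_3\}}(t)=\#\{(x_1,x_2,x_3)\in\mathbb{Z}^3:\text{ all }x_j\ge0,\ x_1b_1+x_2b_2+x_3b_3=t\}$. *)

theory Defs
  imports Complex_Main "HOL-Computational_Algebra.Polynomial"
begin

definition qp_rep :: "(nat \<Rightarrow> int) \<Rightarrow> nat \<Rightarrow> nat \<Rightarrow> (nat \<Rightarrow> int poly) \<Rightarrow> bool" where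
  "qp_rep f T C F \<longleftrightarrow> T > 0 \<and> C > 0 \<and>
     (\<forall>i<T. \<forall>m. T * m + i > C \<longrightarrow> f (T * m + i) = poly (F i) (int m))"

text \<open>The ring R. Its elements are represented by functions on all of the natural numbers;
  identities between them are stated for all sufficiently large arguments.\<close>

definition quasi_polys :: "(nat \<Rightarrow> int) set" where
  "quasi_polys = {f. \<exists>T C F. qp_rep f T C F}"

text \<open>The next two properties do not depend on the chosen representation, since they amount to
  eventual positivity and eventual nonnegativity. In the first one each constituent is
  automatically nonzero because the leading coefficient of the zero polynomial is 0.\<close>

definition qp_pos :: "(nat \<Rightarrow> int) \<Rightarrow> bool" where
  "qp_pos f \<longleftrightarrow> (\<exists>T C F. qp_rep f T C F \<and> (\<forall>i<T. lead_coeff (F i) > 0))"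

definition qp_nonneg :: "(nat \<Rightarrow> int) \<Rightarrow> bool" where
  "qp_nonneg f \<longleftrightarrow> (\<exists>T C F. qp_rep f T C F \<and> (\<forall>i<T. F i = 0 \<or> lead_coeff (F i) > 0))"

definition qp_dvd :: "(nat \<Rightarrow> int) \<Rightarrow> (nat \<Rightarrow> int) \<Rightarrow> bool" where
  "qp_dvd g f \<longleftrightarrow> (\<forall>\<^sub>F n in sequentially. g n \<noteq> 0 \<and> g n dvd f n)"

text \<open>A generalized gcd is unique only up to its values at finitely many arguments, so it is
  a relation here.\<close>

definition is_ggcd :: "(nat \<Rightarrow> int) set \<Rightarrow> (nat \<Rightarrow> int) \<Rightarrow> bool" where
  "is_ggcd A d \<longleftrightarrow> d \<in> quasi_polys \<and> qp_nonneg d \<and> (\<forall>f\<in>A. qp_dvd d f) \<and>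
     (\<forall>p\<in>quasi_polys. (\<forall>f\<in>A. qp_dvd p f) \<longrightarrow> qp_dvd p d)"

text \<open>\<open>qp_inverse b1 b2 u\<close>: \<open>u\<close> is an inverse of \<open>b1\<close> modulo \<open>b2\<close>.
  It is the first member of a Bezout pair in R, not just an inverse at each single argument.\<close>

definition qp_inverse :: "(nat \<Rightarrow> int) \<Rightarrow> (nat \<Rightarrow> int) \<Rightarrow> (nat \<Rightarrow> int) \<Rightarrow> bool" where
  "qp_inverse b1 b2 u \<longleftrightarrow> is_ggcd {b1, b2} (\<lambda>_. 1) \<and> u \<in> quasi_polys \<and>
     (\<exists>v\<in>quasi_polys. \<forall>\<^sub>F n in sequentially. b1 n * u n + b2 n * v n = 1)"

text \<open>The third argument is an integer whenever the sum matters; it is typed as a rational because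
  it is formed from a quotient \<open>m / d0\<close> that is integral only if \<open>d0\<close> divides \<open>m\<close>.\<close>

definition S :: "int \<Rightarrow> int \<Rightarrow> rat \<Rightarrow> int \<Rightarrow> int \<Rightarrow> rat" where
  "S r1 r2 r3 r4 r5 =
     (\<Sum>x\<in>{r1..r2}. frac ((r3 + of_int (r4 * x)) / of_int r5) * of_int r5)"

definition chi :: "int \<Rightarrow> int \<Rightarrow> rat" where
  "chi m d = (if d dvd m then 1 else 0)"

definition denumerant3 :: "int \<Rightarrow> int \<Rightarrow> int \<Rightarrow> int \<Rightarrow> nat" where
  "denumerant3 b1 b2 b3 t = card {(x1, x2, x3). x1 \<ge> 0 \<and> x2 \<ge> 0 \<and> x3 \<ge> 0 \<and>
     x1 * b1 + x2 * b2 + x3 * b3 = t}"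

end

theory Submission
  imports Defs "HOL-Library.FuncSet"
begin

text \<open>Only eventual positivity of the quasi-polynomials matters; everything else is an argument at a
  fixed large \<open>n\<close>. Divide \<open>x1 a1 + x2 a2 + x3 a3 = m\<close> by \<open>d0\<close>. Modulo \<open>d\<close> the resulting equation
  forces \<open>x3\<close> to be congruent to \<open>x0\<close>, so \<open>x3 = x0 + d k\<close>, and division by \<open>d\<close> turns it into an
  equation with coefficients \<open>b1\<close>, \<open>b2\<close>, \<open>a3'\<close>. Summing Popoviciu's formula for two coprime
  coefficients over all \<open>k\<close> gives the claim.\<close>

section \<open>Signs of quasi-polynomials and gcds at large arguments\<close>

lemma poly_eventually_pos_int:
  fixes p :: "int poly"
  assumes "lead_coeff p > 0"
  shows "\<exists>N. \<forall>x\<ge>N. poly p x > 0"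
  using assms
proof (induction p)
  case 0
  then show ?case by simp
next
  case (pCons a p)
  show ?case
  proof (cases "p = 0")
    case True
    then show ?thesis using pCons.prems by simp
  next
    case False
    then obtain N where N: "\<forall>x\<ge>N. poly p x > 0" using pCons by auto
    \<comment> \<open>By integrality the tail is at least 1, so for \<open>x \<ge> 0\<close> the
      value is at least \<open>a + x\<close>; the bound \<open>1 - a\<close> makes this at least
      1.\<close>
    have "poly (pCons a p) x > 0" if "x \<ge> max N (max 0 (1 - a))" for x
    proof -
      have "poly p x \<ge> 1" "x \<ge> 0" using N that by force+
      then have "x * poly p x \<ge> x * 1" by (intro mult_left_mono)
      then show ?thesis using that by simp
    qed
    then show ?thesis by blast
  qed
qed

text \<open>There are only finitely many constituents, so their thresholds have a common bound.
  Leaving \<open>P\<close> arbitrary serves both strict and weak positivity.\<close>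

lemma qp_rep_eventually:
  assumes rep: "qp_rep f T C F" and P: "\<And>i. i < T \<Longrightarrow> \<exists>N. \<forall>x\<ge>N. P (poly (F i) x)"
  shows "\<forall>\<^sub>F n in sequentially. P (f n)"
proof -
  have T: "T > 0" using rep by (simp add: qp_rep_def)
  obtain N where N: "\<And>i x. i < T \<Longrightarrow> x \<ge> N i \<Longrightarrow> P (poly (F i) x)"
    using P by metis
  define M where "M = Max (insert 0 ((\<lambda>i. nat (N i)) ` {..<T}))"
  \<comment> \<open>\<open>Suc C\<close> puts \<open>n\<close> in the range where the representation
    holds; \<open>T * M\<close> pushes \<open>n div T\<close> beyond every threshold.\<close>
  have "P (f n)" if n: "n \<ge> max (Suc C) (T * M)" for n
  proof -
    have i: "n mod T < T" using T by simp
    have "nat (N (n mod T)) \<le> M" unfolding M_def using i by (intro Max_ge) auto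
    moreover have "M \<le> n div T"
      using n T by (metis max.boundedE div_le_mono nonzero_mult_div_cancel_left less_not_refl2)
    ultimately have "P (poly (F (n mod T)) (int (n div T)))" by (intro N i) linarith
    moreover have "f (T * (n div T) + n mod T) = poly (F (n mod T)) (int (n div T))"
      using rep i n unfolding qp_rep_def
      by (metis Suc_le_lessD max.boundedE mult_div_mod_eq)
    ultimately show ?thesis by simp
  qed
  then show ?thesis unfolding eventually_sequentially by blast
qed

lemma qp_pos_eventually:
  assumes "qp_pos f"
  shows "\<forall>\<^sub>F n in sequentially. f n > 0"
  using assms unfolding qp_pos_def
  by (auto intro: qp_rep_eventually poly_eventually_pos_int)

lemma qp_nonneg_eventually:
  assumes "qp_nonneg f"
  shows "\<forall>\<^sub>F n in sequentially. f n \<ge> 0"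
proof -
  obtain T C F where "qp_rep f T C F" and F: "\<forall>i<T. F i = 0 \<or> lead_coeff (F i) > 0"
    using assms unfolding qp_nonneg_def by blast
  moreover have "\<exists>N. \<forall>x\<ge>N. poly (F i) x \<ge> 0" if "i < T" for i
    using F that poly_eventually_pos_int[of "F i"] by (cases "F i = 0") (auto, force)
  ultimately show ?thesis using qp_rep_eventually[where P = "\<lambda>y. y \<ge> 0"] by blast
qed

text \<open>The sign normalisation of the gcd gives \<open>d n \<ge> 0\<close>, and divisibility in
  R includes \<open>d n \<noteq> 0\<close>.\<close>

lemma is_ggcd_eventually:
  assumes "is_ggcd A d" and "f \<in> A"
  shows "\<forall>\<^sub>F n in sequentially. d n > 0 \<and> d n dvd f n"
proof -
  have "qp_nonneg d" "qp_dvd d f" using assms by (auto simp: is_ggcd_def)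
  then have "\<forall>\<^sub>F n in sequentially. d n \<ge> 0" "\<forall>\<^sub>F n in sequentially. d n \<noteq> 0 \<and> d n dvd f n"
    by (auto simp: qp_dvd_def qp_nonneg_eventually)
  then show ?thesis by eventually_elim auto
qed

lemma qp_inverse_eventually:
  assumes "qp_inverse b c u"
  shows "\<forall>\<^sub>F n in sequentially. c n dvd b n * u n - 1"
proof -
  obtain v where "\<forall>\<^sub>F n in sequentially. b n * u n + c n * v n = 1"
    using assms by (auto simp: qp_inverse_def)
  then show ?thesis
  proof eventually_elim
    case (elim n)
    then have "b n * u n - 1 = c n * (- v n)" by (simp add: algebra_simps)
    then show ?case by (rule dvdI)
  qed
qed

section \<open>Remainders and linear congruences\<close>

text \<open>This turns \<open>x0\<close> and the summands of \<open>S\<close> into integer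
  remainders.\<close>

lemma frac_of_int_divide:
  assumes "q > 0"
  shows "frac (of_int p / of_int q :: 'a :: floor_ceiling) * of_int q = of_int (p mod q)"
  using assms
  by (simp add: frac_def floor_divide_of_int_eq right_diff_distrib mult.commute
      minus_mult_div_eq_mod[symmetric])

text \<open>With \<open>r = t * u mod b\<close>, the difference \<open>t - a * r\<close> equals
  \<open>(a * u - 1) * (- t) + a * (t * u - r)\<close>, and \<open>b\<close> divides both
  terms.\<close>

lemma mod_solves_congruence:
  fixes a b u t :: int
  assumes "b dvd a * u - 1"
  shows "b dvd t - a * (t * u mod b)"
proof -
  have "b dvd (a * u - 1) * (- t)" using assms by (rule dvd_mult2)
  moreover have "b dvd a * (t * u - t * u mod b)" by (simp add: dvd_minus_mod)
  ultimately have "b dvd (a * u - 1) * (- t) + a * (t * u - t * u mod b)" by (rule dvd_add)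
  then show ?thesis by (simp add: algebra_simps)
qed

text \<open>Multiplying the congruence by the inverse \<open>u\<close> identifies the class of
  \<open>x\<close> as that of \<open>t * u\<close>. The remainder is the least nonnegative member of
  the class, so a nonnegative \<open>x\<close> lies a nonnegative number of steps above it.\<close>

lemma congruence_solution_shift:
  fixes a b u x t :: int
  assumes b: "b > 0" and u: "b dvd a * u - 1" and x: "x \<ge> 0" and dvd: "b dvd t - a * x"
  obtains k where "k \<ge> 0" and "x = t * u mod b + b * k"
proof (rule that)
  have "b dvd (t - a * x) * u + (a * u - 1) * x"
    using u dvd by (intro dvd_add dvd_mult2)
  then have "b dvd t * u - x" by (simp add: algebra_simps)
  then have "t * u mod b = x mod b" by (simp add: mod_eq_dvd_iff)
  then show "x = t * u mod b + b * (x div b)" by simp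
qed (use x b in \<open>simp add: pos_imp_zdiv_nonneg_iff\<close>)

section \<open>Popoviciu's formula for two coprime coefficients\<close>

definition solutions2 :: "int \<Rightarrow> int \<Rightarrow> int \<Rightarrow> (int \<times> int) set" where
  "solutions2 a b t = {(x, y). x \<ge> 0 \<and> y \<ge> 0 \<and> x * a + y * b = t}"

lemma finite_solutions2:
  assumes "a > 0" and "b > 0"
  shows "finite (solutions2 a b t)"
proof (rule finite_subset)
  show "solutions2 a b t \<subseteq> {0..t} \<times> {0..t}"
  proof clarify
    fix x y assume "(x, y) \<in> solutions2 a b t"
    then have xy: "x \<ge> 0" "y \<ge> 0" "x * a + y * b = t" by (auto simp: solutions2_def)
    moreover have "x * 1 \<le> x * a" "y * 1 \<le> y * b"
      using xy assms by (intro mult_left_mono; simp)+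
    ultimately show "x \<in> {0..t} \<and> y \<in> {0..t}" by auto
  qed
qed simp

text \<open>Let \<open>r\<close> and \<open>s\<close> be the least residues that \<open>x\<close>
  and \<open>y\<close> must have modulo \<open>b\<close> and \<open>a\<close>. Then
  \<open>t = a * r + b * s + a * b * q\<close>, and the solutions arise by distributing
  \<open>q\<close> steps between the two coordinates. Their number \<open>q + 1\<close> is the
  right-hand side.\<close>

lemma popoviciu:
  fixes a b u v t :: int
  assumes a: "a > 0" and b: "b > 0" and u: "b dvd a * u - 1" and v: "a dvd b * v - 1" and t: "t \<ge> 0"
  shows "(of_nat (card (solutions2 a b t)) :: 'a :: linordered_field) =
    of_int t / of_int (a * b) + 1 - of_int (t * u mod b) / of_int b - of_int (t * v mod a) / of_int a"
proof -
  define r s where "r = t * u mod b" and "s = t * v mod a"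
  have rs: "0 \<le> r" "r < b" "0 \<le> s" "s < a" using a b by (auto simp: r_def s_def)
  \<comment> \<open>A common divisor divides both \<open>a * u\<close> and \<open>a * u - 1\<close>,
    hence 1.\<close>
  have cop: "coprime a b"
  proof (rule coprimeI)
    fix c assume "c dvd a" "c dvd b"
    then have "c dvd a * u" "c dvd a * u - 1" using u by (auto intro: dvd_trans)
    then have "c dvd a * u - (a * u - 1)" by (rule dvd_diff)
    then show "is_unit c" by simp
  qed
  have "b dvd (t - a * r) - b * s" "a dvd (t - b * s) - a * r"
    using mod_solves_congruence[OF u, of t] mod_solves_congruence[OF v, of t]
    by (auto simp: r_def s_def intro: dvd_diff)
  then have "a * b dvd t - a * r - b * s"
    using cop by (intro divides_mult) (auto simp: algebra_simps)
  then obtain q where "t - a * r - b * s = a * b * q" by (elim dvdE)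
  then have q: "t = a * r + b * s + a * b * q" by simp
  \<comment> \<open>Since \<open>t \<ge> 0\<close> and both residue terms are below
    \<open>a * b\<close>, \<open>q\<close> exceeds -2. The value \<open>q = -1\<close> can occur:
    then there is no solution, and \<open>q + 1 = 0\<close> is still the correct count. Thus
    \<open>nat (q + 1)\<close> below loses nothing.\<close>
  have "a * r < a * b" "b * s < b * a" using rs a b by (auto intro: mult_strict_left_mono)
  then have "a * b * (- 2) < a * b * q" using q t by (simp add: mult.commute)
  then have q': "q \<ge> - 1" using a b by (simp only: mult_less_cancel_left_pos mult_pos_pos)
  have "bij_betw (\<lambda>i. (r + b * i, s + a * (q - i))) {0..q} (solutions2 a b t)"
    unfolding bij_betw_def
  proof (intro conjI set_eqI iffI)
    show "inj_on (\<lambda>i. (r + b * i, s + a * (q - i))) {0..q}"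
      using b by (auto simp: inj_on_def)
    fix p
    assume "p \<in> (\<lambda>i. (r + b * i, s + a * (q - i))) ` {0..q}"
    then obtain i where i: "i \<ge> 0" "i \<le> q" and p: "p = (r + b * i, s + a * (q - i))" by auto
    have "b * i \<ge> 0" "a * (q - i) \<ge> 0" using i a b by simp_all
    moreover have "(r + b * i) * a + (s + a * (q - i)) * b = t" by (simp add: q algebra_simps)
    ultimately show "p \<in> solutions2 a b t" using rs unfolding solutions2_def p by simp
  next
    fix p
    assume "p \<in> solutions2 a b t"
    then obtain x y where p: "p = (x, y)" and xy: "x \<ge> 0" "y \<ge> 0" "x * a + y * b = t"
      by (auto simp: solutions2_def)
    have "t - a * x = b * y" "t - b * y = a * x" using xy(3) by (auto simp: algebra_simps)
    then obtain i j where ij: "i \<ge> 0" "x = r + b * i" "j \<ge> 0" "y = s + a * j"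
      using congruence_solution_shift[OF b u \<open>x \<ge> 0\<close>] congruence_solution_shift[OF a v \<open>y \<ge> 0\<close>]
      unfolding r_def s_def by (metis dvd_triv_left)
    \<comment> \<open>Substituting both shifted coordinates into the equation and comparing with the
      decomposition of \<open>t\<close> leaves \<open>i + j = q\<close>.\<close>
    have "a * b * (i + j) = a * b * q" using xy(3) q ij by (simp add: algebra_simps)
    then have "j = q - i" using a b by simp
    then show "p \<in> (\<lambda>i. (r + b * i, s + a * (q - i))) ` {0..q}" using ij p by auto
  qed
  then have "card (solutions2 a b t) = nat (q + 1)" by (simp add: bij_betw_same_card[symmetric])
  then have "(of_nat (card (solutions2 a b t)) :: 'a) = of_int (q + 1)" using q' by simp
  also have "\<dots> = of_int t / of_int (a * b) + 1 - of_int r / of_int b - of_int s / of_int a"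
    using a b by (simp add: q field_simps)
  finally show ?thesis by (simp add: r_def s_def)
qed

section \<open>Slicing, scaling and reducing the three-coefficient count\<close>

text \<open>The solutions are sliced by the third coordinate, which is at most
  \<open>t div c\<close> because the other two terms are nonnegative. For negative \<open>t\<close>
  the range is empty, as is the solution set.\<close>

lemma denumerant3_eq_sum:
  assumes a: "a > 0" and b: "b > 0" and c: "c > 0"
  shows "denumerant3 a b c t = (\<Sum>k\<in>{0..t div c}. card (solutions2 a b (t - c * k)))"
proof -
  have "bij_betw (\<lambda>(k, x, y). (x, y, k)) (SIGMA k:{0..t div c}. solutions2 a b (t - c * k))
      {(x, y, k). x \<ge> 0 \<and> y \<ge> 0 \<and> k \<ge> 0 \<and> x * a + y * b + k * c = t}"
  proof (rule bij_betwI[where g = "\<lambda>(x, y, k). (k, x, y)"])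
    have "k \<le> t div c" if "x \<ge> 0" "y \<ge> 0" "x * a + y * b + k * c = t" for x y k
    proof -
      have "x * a \<ge> 0" "y * b \<ge> 0" using that a b by auto
      then have "k * c \<le> t" using that(3) by linarith
      then show ?thesis using zdiv_mono1[of "k * c" t c] c by simp
    qed
    then show "(\<lambda>(x, y, k). (k, x, y)) \<in> {(x, y, k). x \<ge> 0 \<and> y \<ge> 0 \<and> k \<ge> 0 \<and> x * a + y * b + k * c = t}
        \<rightarrow> (SIGMA k:{0..t div c}. solutions2 a b (t - c * k))"
      by (auto simp: solutions2_def algebra_simps)
  qed (auto simp: solutions2_def algebra_simps)
  then show ?thesis
    unfolding denumerant3_def
    by (simp add: bij_betw_same_card[symmetric] finite_solutions2[OF a b])
qed

lemma denumerant3_mult: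
  assumes "g \<noteq> 0"
  shows "denumerant3 (g * a) (g * b) (g * c) (g * t) = denumerant3 a b c t"
proof -
  have "x * (g * a) + y * (g * b) + z * (g * c) = g * t \<longleftrightarrow> x * a + y * b + z * c = t" for x y z
  proof -
    have "x * (g * a) + y * (g * b) + z * (g * c) = g * (x * a + y * b + z * c)"
      by (simp add: algebra_simps)
    then show ?thesis using assms by (metis mult_cancel_left)
  qed
  then show ?thesis by (simp add: denumerant3_def)
qed

lemma denumerant3_eq_0:
  assumes "g dvd a" and "g dvd b" and "g dvd c" and "\<not> g dvd t"
  shows "denumerant3 a b c t = 0"
proof -
  have "x * a + y * b + z * c \<noteq> t" for x y z
    using assms by (metis dvd_add dvd_mult)
  then show ?thesis by (auto simp: denumerant3_def card_eq_0_iff)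
qed

text \<open>Modulo \<open>d\<close> only the third term survives, so the third coordinate is
  \<open>z0 + d * k\<close>; substituting and cancelling \<open>d\<close> gives the smaller
  equation. As \<open>z0\<close> is a least residue, nonnegativity of the coordinate matches that of
  \<open>k\<close>. The new right-hand side may be negative, in which case both counts are
  0.\<close>

lemma denumerant3_reduce:
  fixes a b c d u t :: int
  assumes d: "d > 0" and u: "d dvd c * u - 1"
  shows "denumerant3 (d * a) (d * b) c t = denumerant3 a b c ((t - c * (t * u mod d)) div d)"
proof -
  define z0 t' where "z0 = t * u mod d" and "t' = (t - c * z0) div d"
  have z0: "z0 \<ge> 0" using d by (simp add: z0_def)
  have "d dvd t - c * z0" unfolding z0_def by (rule mod_solves_congruence[OF u])
  then have t: "t = c * z0 + d * t'" by (simp add: t'_def)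
  have eq: "x * (d * a) + y * (d * b) + (z0 + d * k) * c = t \<longleftrightarrow> x * a + y * b + k * c = t'" for x y k
  proof -
    have "x * (d * a) + y * (d * b) + (z0 + d * k) * c = c * z0 + d * (x * a + y * b + k * c)"
      by (simp add: algebra_simps)
    then show ?thesis using t d by simp
  qed
  have "bij_betw (\<lambda>(x, y, k). (x, y, z0 + d * k))
      {(x, y, k). x \<ge> 0 \<and> y \<ge> 0 \<and> k \<ge> 0 \<and> x * a + y * b + k * c = t'}
      {(x, y, z). x \<ge> 0 \<and> y \<ge> 0 \<and> z \<ge> 0 \<and> x * (d * a) + y * (d * b) + z * c = t}"
    unfolding bij_betw_def
  proof (intro conjI subset_antisym subsetI)
    show "inj_on (\<lambda>(x, y, k). (x, y, z0 + d * k))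
        {(x, y, k). x \<ge> 0 \<and> y \<ge> 0 \<and> k \<ge> 0 \<and> x * a + y * b + k * c = t'}"
      using d by (auto simp: inj_on_def)
    fix p
    assume "p \<in> (\<lambda>(x, y, k). (x, y, z0 + d * k)) `
        {(x, y, k). x \<ge> 0 \<and> y \<ge> 0 \<and> k \<ge> 0 \<and> x * a + y * b + k * c = t'}"
    then show "p \<in> {(x, y, z). x \<ge> 0 \<and> y \<ge> 0 \<and> z \<ge> 0 \<and> x * (d * a) + y * (d * b) + z * c = t}"
      using z0 d by (auto simp: eq)
  next
    fix p
    assume "p \<in> {(x, y, z). x \<ge> 0 \<and> y \<ge> 0 \<and> z \<ge> 0 \<and> x * (d * a) + y * (d * b) + z * c = t}"
    then obtain x y z where p: "p = (x, y, z)" "x \<ge> 0" "y \<ge> 0" "z \<ge> 0"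
      and sol: "x * (d * a) + y * (d * b) + z * c = t" by auto
    have "t - c * z = d * (x * a + y * b)" using sol by (simp add: algebra_simps)
    then have "d dvd t - c * z" by (rule dvdI)
    then obtain k where "k \<ge> 0" "z = z0 + d * k"
      using congruence_solution_shift[OF d u \<open>z \<ge> 0\<close>] unfolding z0_def by blast
    then show "p \<in> (\<lambda>(x, y, k). (x, y, z0 + d * k)) `
        {(x, y, k). x \<ge> 0 \<and> y \<ge> 0 \<and> k \<ge> 0 \<and> x * a + y * b + k * c = t'}"
      using p sol eq[of x y k] by (intro image_eqI[where x = "(x, y, k)"]) auto
  qed
  then show ?thesis
    unfolding denumerant3_def t'_def[unfolded z0_def, symmetric]
    by (simp add: bij_betw_same_card[symmetric])
qed

section \<open>Summation of Popoviciu's formula and the final assembly\<close>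

lemma S_of_int:
  assumes "r5 > 0"
  shows "S r1 r2 (of_int r3) r4 r5 = (\<Sum>x\<in>{r1..r2}. of_int ((r3 + r4 * x) mod r5))"
  unfolding S_def by (intro sum.cong refl) (use frac_of_int_divide[OF assms] in \<open>metis of_int_add\<close>)

text \<open>Popoviciu's formula is summed over the slices. No sign of \<open>t\<close> is assumed,
  since the reduced right-hand side can be negative; all sums are then empty.\<close>

lemma denumerant3_coprime:
  fixes a b c t u v :: int
  assumes a: "a > 0" and b: "b > 0" and c: "c > 0" and u: "b dvd a * u - 1" and v: "a dvd b * v - 1"
  shows "of_nat (denumerant3 a b c t) =
    (\<Sum>x\<in>{0..t div c}. (of_int t - of_int (c * x)) / of_int (a * b) + 1)
      - 1 / of_int b * S 0 (t div c) (of_int t * of_int u) (- c * u) b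
      - 1 / of_int a * S 0 (t div c) (of_int t * of_int v) (- c * v) a"
proof -
  have summand: "of_nat (card (solutions2 a b (t - c * x))) =
      ((of_int t - of_int (c * x)) / of_int (a * b) + 1 :: rat)
        - 1 / of_int b * of_int ((t * u + - c * u * x) mod b)
        - 1 / of_int a * of_int ((t * v + - c * v * x) mod a)" if "x \<in> {0..t div c}" for x
  proof -
    \<comment> \<open>The summation range is exactly what keeps \<open>t - c * x\<close>
      nonnegative, as Popoviciu's formula requires.\<close>
    have "c * x \<le> c * (t div c)" using that c by simp
    also have "\<dots> \<le> t" using c pos_mod_sign[of c t] by (simp add: minus_mod_eq_mult_div[symmetric])
    finally have "t - c * x \<ge> 0" by simp
    moreover have "t * u + - c * u * x = (t - c * x) * u" "t * v + - c * v * x = (t - c * x) * v"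
      by (simp_all add: algebra_simps)
    ultimately show ?thesis using popoviciu[OF a b u v, of "t - c * x", where 'a = rat] by simp
  qed
  have "S 0 (t div c) (of_int t * of_int u) (- c * u) b =
      (\<Sum>x\<in>{0..t div c}. of_int ((t * u + - c * u * x) mod b))"
    "S 0 (t div c) (of_int t * of_int v) (- c * v) a =
      (\<Sum>x\<in>{0..t div c}. of_int ((t * v + - c * v * x) mod a))"
    using S_of_int[OF b, of 0 _ "t * u"] S_of_int[OF a, of 0 _ "t * v"] by simp_all
  then show ?thesis
    by (simp only: denumerant3_eq_sum[OF a b c] of_nat_sum summand sum_subtractf sum_distrib_left
        cong: sum.cong)
qed

theorem theorem4p3:
  fixes a1 a2 a3 m :: "nat \<Rightarrow> int"
    and d0 d a1' a2' a3' b1 b2 :: "nat \<Rightarrow> int"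
    and a3_inv b1_inv b2_inv :: "nat \<Rightarrow> int"
    and m' x0 mt C :: "nat \<Rightarrow> rat"
    and K :: "nat \<Rightarrow> int"
  assumes "qp_pos a1" and "qp_pos a2" and "qp_pos a3" and "qp_pos m"
    and "is_ggcd {a1, a2, a3} d0"
    and "\<And>n. m' n = of_int (m n) / of_int (d0 n)"
    and "\<And>n. a1' n = a1 n div d0 n"
    and "\<And>n. a2' n = a2 n div d0 n"
    and "\<And>n. a3' n = a3 n div d0 n"
    and "is_ggcd {a1', a2'} d"
    and "qp_inverse a3' d a3_inv"
    and "\<And>n. x0 n = frac (m' n * of_int (a3_inv n) / of_int (d n)) * of_int (d n)"
    and "\<And>n. mt n = (m' n - of_int (a3' n) * x0 n) / of_int (d n)"
    and "\<And>n. b1 n = a1' n div d n"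
    and "\<And>n. b2 n = a2' n div d n"
    and "qp_inverse b1 b2 b1_inv"
    and "qp_inverse b2 b1 b2_inv"
    and "\<And>n. K n = \<lfloor>mt n / of_int (a3' n)\<rfloor>"
    and "\<And>n. C n = (\<Sum>x\<in>{0..K n}.
           (mt n - of_int (a3' n * x)) / of_int (b1 n * b2 n) + 1)"
  shows "\<forall>\<^sub>F n in sequentially.
    of_nat (denumerant3 (a1 n) (a2 n) (a3 n) (m n)) =
      chi (m n) (d0 n) *
        (C n
         - 1 / of_int (b2 n) *
             S 0 (K n) (mt n * of_int (b1_inv n)) (- a3' n * b1_inv n) (b2 n)
         - 1 / of_int (b1 n) *
             S 0 (K n) (mt n * of_int (b2_inv n)) (- a3' n * b2_inv n) (b1 n))"
proof -
  note m'_def = assms(6) and a1'_def = assms(7) and a2'_def = assms(8) and a3'_def = assms(9)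
    and x0_def = assms(12) and mt_def = assms(13) and b1_def = assms(14) and b2_def = assms(15)
    and K_def = assms(18) and C_def = assms(19)
  have "\<forall>\<^sub>F n in sequentially. d0 n > 0 \<and> d0 n dvd a1 n"
    "\<forall>\<^sub>F n in sequentially. d0 n > 0 \<and> d0 n dvd a2 n"
    "\<forall>\<^sub>F n in sequentially. d0 n > 0 \<and> d0 n dvd a3 n"
    using is_ggcd_eventually[OF assms(5)] by auto
  moreover have "\<forall>\<^sub>F n in sequentially. d n > 0 \<and> d n dvd a1' n"
    "\<forall>\<^sub>F n in sequentially. d n > 0 \<and> d n dvd a2' n"
    using is_ggcd_eventually[OF assms(10)] by auto
  moreover note qp_pos_eventually[OF assms(1)] qp_pos_eventually[OF assms(2)]
    qp_pos_eventually[OF assms(3)] qp_inverse_eventually[OF assms(11)]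
    qp_inverse_eventually[OF assms(16)] qp_inverse_eventually[OF assms(17)]
  ultimately show ?thesis
  proof eventually_elim
    case (elim n)
    show ?case
    proof (cases "d0 n dvd m n")
      \<comment> \<open>Here \<open>chi\<close> is 0, and \<open>d0 n\<close> divides every
        left-hand side but not \<open>m n\<close>, so there are no solutions.\<close>
      case False
      then show ?thesis using elim by (simp add: chi_def denumerant3_eq_0)
    next
      case True
      \<comment> \<open>\<open>M\<close> and \<open>T\<close> are the integers behind the rationals
        \<open>m' n\<close> and \<open>mt n\<close>; the division in \<open>T\<close> is exact
        because \<open>a3_inv n\<close> inverts \<open>a3' n\<close> modulo
        \<open>d n\<close>.\<close>
      define M where "M = m n div d0 n"
      define T where "T = (M - a3' n * (M * a3_inv n mod d n)) div d n"
      have a: "a1 n = d0 n * a1' n" "a2 n = d0 n * a2' n" "a3 n = d0 n * a3' n" "m n = d0 n * M"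
        using elim True by (simp_all add: a1'_def a2'_def a3'_def M_def)
      have a': "a1' n = d n * b1 n" "a2' n = d n * b2 n"
        using elim by (simp_all add: b1_def b2_def)
      have pos: "b1 n > 0" "b2 n > 0" "a3' n > 0"
        using elim a a' by (simp_all add: zero_less_mult_iff)
      have m': "m' n = of_int M" using elim a(4) by (simp add: m'_def)
      have "d n dvd M - a3' n * (M * a3_inv n mod d n)"
        using elim by (intro mod_solves_congruence)
      then have "of_int (M - a3' n * (M * a3_inv n mod d n)) = (of_int (d n * T) :: rat)"
        by (simp add: T_def)
      moreover have "x0 n = of_int (M * a3_inv n mod d n)"
        using frac_of_int_divide[of "d n" "M * a3_inv n", where 'a = rat] elim by (simp add: x0_def m')
      ultimately have mt: "mt n = of_int T" using elim by (simp add: mt_def m')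
      have K: "K n = T div a3' n" by (simp add: K_def mt floor_divide_of_int_eq)
      \<comment> \<open>First the common factor \<open>d0 n\<close> is cancelled, then the factor
        \<open>d n\<close> shared by the first two coefficients is removed.\<close>
      have "denumerant3 (a1 n) (a2 n) (a3 n) (m n) = denumerant3 (b1 n) (b2 n) (a3' n) T"
        unfolding T_def a a' using elim by (simp add: denumerant3_mult denumerant3_reduce)
      then show ?thesis
        using denumerant3_coprime[OF pos, of "b1_inv n" "b2_inv n" T] elim True
        by (simp add: chi_def C_def K mt)
    qed
  qed
qed

end
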